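(* Let $\{f_d\}_{d\ge 0}$ be a sequence of integrable functions on $D^{\mathbb N}$ converging dominantly to $f:D^{\mathbb N}\to\mathbb R$, such that each $f_d$ depends only on the variables $x_1,\ldots,x_d$. Suppose in addition that the convergence $f_d\to f$ is uniform almost everywhere, or that the following less restrictive assumption is satisfied: there is a sequence $\{g_d\}_{d\ge 0}$ of integrable functions, $g_d$ depending only on $x_1,\ldots,x_d$, that converges dominantly to the zero function and is such that for almost every $\boldsymbol x=(x_1,x_2,x_3,\ldots)\in D^{\mathbb N}$ $$|f_d(\boldsymbol x)-f(\boldsymbol x)|\le g_d(x_1,\ldots,x_d)\qquad\text{for all } d\ge 0. \qquad ( * )$$ Then for almost every $\boldsymbol a=(a_1,a_2,a_3,\ldots)\in D^{\mathbb N}$ $$\int_{D^{\mathbb N}} f\,\mathrm d\mu \;=\; \lim_{d\to\infty}\int_{D^d} f(x_1,\ldots,x_d,a_{d+1},a_{d+2},\ldots)\,\mathrm d\mu_d(x_1,\ldots,x_d). \qquad ( ** )$$ Moreover, if $( * )$ holds for all $\boldsymbol x\in D^{\mathbb N}$, then $( ** )$ holds for every anchor $\boldsymbol a\in D^{\mathbb N}$ for which the functions $$D^{\mathbb N}\ni \boldsymbol x=(x_1,x_2,x_3,\ldots)\mapsto f(x_1,\ldots,x_d,a_{d+1},a_{d+2},\ldots),\qquad d\ge 0,$$ are measurable.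
   Context: $D\subseteq\mathbb R$ is a Borel set, $\mathbb N=\{1,2,3,\ldots\}$, and $D^{\mathbb N}$ is the set of all infinite sequences $\boldsymbol x=(x_1,x_2,x_3,\ldots)$ with $x_j\in D$. $\mu_1$ is a probability measure on the Borel $\sigma$-field of $D$, $\mu_d=\times_{j=1}^d\mu_1$ is the $d$-fold product measure on $D^d$, and $\mu=\times_{j=1}^\infty\mu_1$ is the countable product measure on $D^{\mathbb N}$. Integrability, measurability and "almost every(where)" for functions on $D^{\mathbb N}$ refer to $\mu$. A function of $x_1,\ldots,x_d$ is identified with the function on $D^{\mathbb N}$ depending only on those variables (for $d=0$: a constant). A sequence $\{f_d\}_{d\ge0}$ of integrable functions converges dominantly to $f$ if (i) $\lim_{d\to\infty}f_d(\boldsymbol x)=f(\boldsymbol x)$ for almost every $\boldsymbol x$, and (ii) there is an integrable function $g$ with $|f_d(\boldsymbol x)|\le|g(\boldsymbol x)|$ for almost every $\boldsymbol x$ (for all $d$). *)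

theory Defs
  imports "HOL-Probability.Probability"
begin

text \<open>Sequences are indexed from 1; points of the product spaces are extensional functions,
  i.e. \<open>undefined\<close> outside the index set.\<close>

definition seq_space :: "real set \<Rightarrow> (nat \<Rightarrow> real) set" where
  "seq_space D = (\<Pi>\<^sub>E i\<in>{1..}. D)"

text \<open>Both product measures are taken completed: the almost everywhere limit of integrable
  functions is in general measurable for the completed product measure only, and its integral has
  to be meaningful. For functions measurable with respect to the product \<open>\<sigma>\<close>-field
  the completion changes neither integrability nor the value of the integral.\<close>

definition seq_measure :: "real measure \<Rightarrow> (nat \<Rightarrow> real) measure" where
  "seq_measure M = completion (PiM {1..} (\<lambda>_. M))"

definition fin_measure :: "real measure \<Rightarrow> nat \<Rightarrow> (nat \<Rightarrow> real) measure" where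
  "fin_measure M d = completion (PiM {1..d} (\<lambda>_. M))"

definition depends_on_first :: "real set \<Rightarrow> nat \<Rightarrow> ((nat \<Rightarrow> real) \<Rightarrow> real) \<Rightarrow> bool" where
  "depends_on_first D d h \<longleftrightarrow>
     (\<forall>x\<in>seq_space D. \<forall>y\<in>seq_space D. (\<forall>i\<in>{1..d}. x i = y i) \<longrightarrow> h x = h y)"

definition converges_dominantly ::
  "'a measure \<Rightarrow> (nat \<Rightarrow> 'a \<Rightarrow> real) \<Rightarrow> ('a \<Rightarrow> real) \<Rightarrow> bool" where
  "converges_dominantly N F f \<longleftrightarrow>
     (\<forall>d. integrable N (F d)) \<and>
     (AE x in N. (\<lambda>d. F d x) \<longlonglongrightarrow> f x) \<and>
     (\<exists>g. integrable N g \<and> (AE x in N. \<forall>d. \<bar>F d x\<bar> \<le> \<bar>g x\<bar>))"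

definition converges_uniformly_ae ::
  "'a measure \<Rightarrow> (nat \<Rightarrow> 'a \<Rightarrow> real) \<Rightarrow> ('a \<Rightarrow> real) \<Rightarrow> bool" where
  "converges_uniformly_ae N F f \<longleftrightarrow>
     (\<exists>Z\<in>null_sets N. uniform_limit (space N - Z) F f sequentially)"

text \<open>The integrable functions \<open>g\<^sub>d(x\<^sub>1,\<dots>,x\<^sub>d)\<close>
  that converge dominantly to zero.\<close>

definition dominant_null_sequence ::
  "real set \<Rightarrow> real measure \<Rightarrow> (nat \<Rightarrow> (nat \<Rightarrow> real) \<Rightarrow> real) \<Rightarrow> bool" where
  "dominant_null_sequence D M g \<longleftrightarrow>
     (\<forall>d. depends_on_first D d (g d)) \<and> converges_dominantly (seq_measure M) g (\<lambda>_. 0)"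

text \<open>The point \<open>(x\<^sub>1,\<dots>,x\<^sub>d,a\<^sub>d\<^sub>+\<^sub>1,a\<^sub>d\<^sub>+\<^sub>2,\<dots>)\<close>. Only the
  first \<open>d\<close> coordinates of \<open>x\<close> are used, so \<open>x\<close> may be a point of the finite or of the
  infinite product.\<close>

definition anchored :: "nat \<Rightarrow> (nat \<Rightarrow> real) \<Rightarrow> (nat \<Rightarrow> real) \<Rightarrow> (nat \<Rightarrow> real)" where
  "anchored d a x = merge {1..d} {Suc d..} (x, a)"

text \<open>The limit relation for the anchor \<open>a\<close>. As the Bochner integral of a non-integrable
  function is 0 by convention, existence of all the integrals involved is part of it.\<close>

definition anchored_integrals_converge ::
  "real measure \<Rightarrow> ((nat \<Rightarrow> real) \<Rightarrow> real) \<Rightarrow> (nat \<Rightarrow> real) \<Rightarrow> bool" where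
  "anchored_integrals_converge M f a \<longleftrightarrow>
     integrable (seq_measure M) f \<and>
     (\<forall>d. integrable (fin_measure M d) (\<lambda>x. f (anchored d a x))) \<and>
     (\<lambda>d. \<integral>x. f (anchored d a x) \<partial>fin_measure M d)
       \<longlonglongrightarrow> (\<integral>x. f x \<partial>seq_measure M)"

end

theory Submission
  imports Defs
begin

text \<open>
  Dominated convergence gives \<open>\<integral> F\<^sub>d \<longrightarrow> \<integral> f\<close>, so it suffices that the anchored integral
  of \<open>f\<close> over the first \<open>d\<close> variables gets close to \<open>\<integral> F\<^sub>d\<close>. Since \<open>F\<^sub>d\<close> sees only the first
  \<open>d\<close> variables, \<open>\<integral> F\<^sub>d\<close> is itself an anchored integral, for every anchor
  (\<open>integral_anchored_depends_on_first\<close>). The difference of the two is therefore an anchored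
  integral of \<open>F\<^sub>d - f\<close>, and it is bounded by the anchored integral of \<open>g\<^sub>d\<close>, which is
  \<open>\<integral> g\<^sub>d\<close> by the same lemma and tends to 0
  (\<open>anchored_integrals_converge_if_approximable\<close>).

  What remains is to make sense of the restriction of an almost everywhere statement to the set
  of points with a prescribed tail \<open>a\<^sub>d\<^sub>+\<^sub>1, a\<^sub>d\<^sub>+\<^sub>2, \<dots>\<close>, which may be
  null. Replacing the
  first \<open>d\<close> coordinates of a random sequence by independent copies does not change its distribution
  (\<open>distr_anchored\<close>). By Fubini's theorem, a property that holds almost everywhere thus holds,
  for almost every anchor \<open>a\<close> and all \<open>d\<close>, at almost every point with that tail
  (\<open>AE_anchored\<close>), and an integrable function has integrable anchored sections for almost every
  anchor (\<open>Fubini_anchored\<close>). This yields the claim for almost every anchor. If the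
  bound holds everywhere, no exceptional anchors arise from it, and it also bounds the anchored sections of
  \<open>f\<close>, so that their measurability is enough for their integrability.

  Uniform convergence almost everywhere does not provide functions \<open>g\<^sub>d\<close> for all \<open>d\<close>: for
  small \<open>d\<close> the difference \<open>F\<^sub>d - f\<close> may be unbounded, and no function of the first \<open>d\<close> variables
  need dominate it. The criterion is therefore phrased with bounds of integral less than \<open>e\<close>
  that exist for large \<open>d\<close> only; in the uniform case these are constants.
\<close>

section \<open>Functions on completed measure spaces\<close>

lemma borel_measurable_completion_AE:
  fixes h h' :: "'a \<Rightarrow> real"
  assumes [measurable]: "h' \<in> borel_measurable N" and eq: "AE x in N. h x = h' x"
  shows "h \<in> borel_measurable (completion N)"
proof (rule measurableI)
  fix A :: "real set" assume A[measurable]: "A \<in> sets borel"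
  have ae: "AE x in completion N. x \<in> h' -` A \<inter> space N \<longleftrightarrow> x \<in> h -` A \<inter> space N"
    using AE_completion[OF eq] by eventually_elim auto
  have "h' -` A \<inter> space N \<in> sets (completion N)"
    by (intro sets_completionI_sets) measurable
  from completion.in_sets_AE[OF ae this] show "h -` A \<inter> space (completion N) \<in> sets (completion N)"
    by simp
qed auto

text \<open>Fubini's theorem needs measurability for the product \<open>\<sigma>\<close>-field itself, so a function that is
  integrable for the completed measure is replaced by an almost everywhere equal version that is
  integrable for the plain one, and its conclusions are carried back to the completion. The next
  two lemmas are these two directions.\<close>

lemma integrable_completion_AE:
  fixes h h' :: "'a \<Rightarrow> real"
  assumes int: "integrable N h'" and eq: "AE x in N. h x = h' x"
  shows "integrable (completion N) h" and "integral\<^sup>L (completion N) h = integral\<^sup>L N h'"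
proof -
  have m: "h' \<in> borel_measurable N" using int by simp
  have h: "h \<in> borel_measurable (completion N)"
    by (rule borel_measurable_completion_AE[OF m eq])
  have h': "h' \<in> borel_measurable (completion N)"
    by (rule measurable_completion[OF m])
  show "integrable (completion N) h"
    using integrable_cong_AE[OF h h' AE_completion[OF eq]] int integrable_completion[OF m] by simp
  show "integral\<^sup>L (completion N) h = integral\<^sup>L N h'"
    using integral_cong_AE[OF h h' AE_completion[OF eq]] integral_completion[OF m] by simp
qed

lemma integrable_completion_obtain_AE:
  fixes h :: "'a \<Rightarrow> real"
  assumes "integrable (completion N) h"
  obtains h' where "integrable N h'" "AE x in N. h x = h' x"
    "integral\<^sup>L (completion N) h = integral\<^sup>L N h'"
proof -
  obtain h' where m: "h' \<in> borel_measurable N" and eq: "AE x in N. h x = h' x"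
    using completion_ex_borel_measurable_real[OF borel_measurable_integrable[OF assms]] by blast
  have "integrable (completion N) h'"
    using integrable_cong_AE[OF borel_measurable_integrable[OF assms] measurable_completion[OF m]
        AE_completion[OF eq]] assms by blast
  then have int: "integrable N h'"
    using integrable_completion[OF m] by blast
  show thesis
    by (rule that[OF int eq integrable_completion_AE(2)[OF int eq]])
qed

text \<open>Completeness is what makes the limit measurable: it agrees almost everywhere with the
  pointwise \<open>lim\<close>, which is measurable.\<close>

lemma integral_converges_dominantly:
  assumes "converges_dominantly (completion N) F f"
  shows "integrable (completion N) f"
    and "(\<lambda>d. integral\<^sup>L (completion N) (F d)) \<longlonglongrightarrow> integral\<^sup>L (completion N) f"
proof -
  let ?C = "completion N"
  obtain w where F: "\<And>d. integrable ?C (F d)" and lim: "AE x in ?C. (\<lambda>d. F d x) \<longlonglongrightarrow> f x"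
    and w: "integrable ?C w" and le: "AE x in ?C. \<forall>d. \<bar>F d x\<bar> \<le> \<bar>w x\<bar>"
    using assms unfolding converges_dominantly_def by blast
  have "(\<lambda>x. lim (\<lambda>d. F d x)) \<in> borel_measurable ?C"
    by (intro borel_measurable_lim_metric borel_measurable_integrable F)
  then obtain h' where h': "h' \<in> borel_measurable N" "AE x in N. lim (\<lambda>d. F d x) = h' x"
    using completion_ex_borel_measurable_real by blast
  have "AE x in N. f x = h' x"
    using h'(2) lim unfolding AE_completion_iff by eventually_elim (auto dest: limI)
  from borel_measurable_completion_AE[OF h'(1) this]
  have f: "f \<in> borel_measurable ?C" .
  have le': "AE x in ?C. norm (F d x) \<le> \<bar>w x\<bar>" for d
    using le by eventually_elim auto
  have w': "integrable ?C (\<lambda>x. \<bar>w x\<bar>)" using w by simp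
  show "integrable ?C f"
    by (rule integrable_dominated_convergence[OF f _ w' lim le']) (use F in auto)
  show "(\<lambda>d. integral\<^sup>L ?C (F d)) \<longlonglongrightarrow> integral\<^sup>L ?C f"
    by (rule integral_dominated_convergence[OF f _ w' lim le']) (use F in auto)
qed

section \<open>Resampling some of the coordinates of an infinite product\<close>

lemma measurable_merge_PiM:
  "(\<lambda>(a, x). merge I J (x, a)) \<in> PiM (I \<union> J) M \<Otimes>\<^sub>M PiM I M \<rightarrow>\<^sub>M PiM (I \<union> J) M"
  unfolding case_prod_beta
proof (rule measurable_PiM_single')
  fix i assume i: "i \<in> I \<union> J"
  show "(\<lambda>p. merge I J (snd p, fst p) i) \<in> PiM (I \<union> J) M \<Otimes>\<^sub>M PiM I M \<rightarrow>\<^sub>M M i"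
    using i by (cases "i \<in> I") (auto simp: merge_def)
qed (auto simp: space_pair_measure space_PiM PiE_iff merge_def extensional_def)

text \<open>Replacing the coordinates in \<open>I\<close> of a random family of independent components by fresh copies
  yields a family of the same distribution. Unlike in \<open>product_sigma_finite.distr_merge\<close>, the
  index sets may be infinite; the whole family is merged, instead of its restriction to \<open>J\<close>, so
  that the anchor can be a point of the full product. On a cylinder, the event splits
  into one about the old coordinates in \<open>J\<close> and one about the new coordinates in \<open>I\<close>.\<close>

lemma distr_merge_PiM:
  fixes M :: "'i \<Rightarrow> 'a measure"
  assumes M: "\<And>i. i \<in> I \<union> J \<Longrightarrow> prob_space (M i)" and disj: "I \<inter> J = {}"
  shows "distr (PiM (I \<union> J) M \<Otimes>\<^sub>M PiM I M) (PiM (I \<union> J) M) (\<lambda>(a, x). merge I J (x, a))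
    = PiM (I \<union> J) M" (is "distr ?R ?P ?m = _")
proof (rule measure_eqI_PiM_infinite[symmetric, OF refl])
  interpret P: prob_space ?P by (rule prob_space_PiM) (rule M)
  interpret Q: prob_space "PiM I M" by (rule prob_space_PiM) (use M in auto)
  have m: "?m \<in> measurable ?R ?P" by (rule measurable_merge_PiM)
  show "finite_measure ?P" by unfold_locales
  show "sets (distr ?R ?P ?m) = sets ?P" by simp
  fix A K assume K: "finite K" "K \<subseteq> I \<union> J" and A[measurable]: "\<And>i. i \<in> K \<Longrightarrow> A i \<in> sets (M i)"
  let ?E = "prod_emb (I \<union> J) M K (Pi\<^sub>E K A)"
  let ?EJ = "prod_emb (I \<union> J) M (K \<inter> J) (Pi\<^sub>E (K \<inter> J) A)"
  let ?EI = "prod_emb I M (K \<inter> I) (Pi\<^sub>E (K \<inter> I) A)"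
  have E: "?E \<in> sets ?P" "?EJ \<in> sets ?P" "?EI \<in> sets (PiM I M)"
    using K A by (auto intro!: sets_PiM_I)
  have vim: "?m -` ?E \<inter> space ?R = ?EJ \<times> ?EI"
  proof (rule set_eqI, clarify)
    fix a x
    show "(a, x) \<in> ?m -` ?E \<inter> space ?R \<longleftrightarrow> (a, x) \<in> ?EJ \<times> ?EI"
    proof (cases "(a, x) \<in> space ?R")
      case True
      then have "merge I J (x, a) \<in> space ?P"
        using measurable_space[OF m] by fastforce
      then have "(a, x) \<in> ?m -` ?E \<inter> space ?R \<longleftrightarrow> (\<forall>i\<in>K. merge I J (x, a) i \<in> A i)"
        using True by (auto simp: prod_emb_iff space_PiM PiE_iff)
      also have "\<dots> \<longleftrightarrow> (\<forall>i\<in>K \<inter> J. a i \<in> A i) \<and> (\<forall>i\<in>K \<inter> I. x i \<in> A i)"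
        using K disj by (auto simp: merge_def)
      also have "\<dots> \<longleftrightarrow> (a, x) \<in> ?EJ \<times> ?EI"
        using True by (auto simp: prod_emb_iff space_pair_measure space_PiM PiE_iff)
      finally show ?thesis .
    next
      case False
      then show ?thesis
        using sets.sets_into_space[OF E(2)] sets.sets_into_space[OF E(3)]
        unfolding space_pair_measure by blast
    qed
  qed
  have "distr ?R ?P ?m ?E = emeasure ?R (?EJ \<times> ?EI)"
    using E m by (simp add: emeasure_distr vim)
  also have "\<dots> = emeasure ?P ?EJ * emeasure (PiM I M) ?EI"
    using E by (intro Q.emeasure_pair_measure_Times) auto
  also have "emeasure ?P ?EJ = (\<Prod>i\<in>K \<inter> J. emeasure (M i) (A i))"
    using M K A by (intro emeasure_PiM_emb) auto
  also have "emeasure (PiM I M) ?EI = (\<Prod>i\<in>K \<inter> I. emeasure (M i) (A i))"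
    using M K A by (intro emeasure_PiM_emb) auto
  also have "(\<Prod>i\<in>K \<inter> J. emeasure (M i) (A i)) * (\<Prod>i\<in>K \<inter> I. emeasure (M i) (A i))
      = (\<Prod>i\<in>K \<inter> J \<union> K \<inter> I. emeasure (M i) (A i))"
    using K disj by (intro prod.union_disjoint[symmetric]) auto
  also have "K \<inter> J \<union> K \<inter> I = K" using K by auto
  also have "(\<Prod>i\<in>K. emeasure (M i) (A i)) = emeasure ?P ?E"
    using M K A by (intro emeasure_PiM_emb[symmetric]) auto
  finally show "emeasure ?P ?E = emeasure (distr ?R ?P ?m) ?E" by simp
qed


section \<open>Anchored functions\<close>

lemma atLeast_1_split: "{1..} = {1..d} \<union> {Suc d..}"
  by auto

lemma measurable_anchored:
  "(\<lambda>(a, x). anchored d a x) \<in> PiM {1..} (\<lambda>_. M) \<Otimes>\<^sub>M PiM {1..d} (\<lambda>_. M) \<rightarrow>\<^sub>M PiM {1..} (\<lambda>_. M)"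
  unfolding anchored_def atLeast_1_split[of d] by (rule measurable_merge_PiM)

lemma distr_anchored:
  assumes "prob_space M"
  shows "distr (PiM {1..} (\<lambda>_. M) \<Otimes>\<^sub>M PiM {1..d} (\<lambda>_. M)) (PiM {1..} (\<lambda>_. M))
    (\<lambda>(a, x). anchored d a x) = PiM {1..} (\<lambda>_. M)"
  unfolding anchored_def atLeast_1_split[of d]
  by (rule distr_merge_PiM) (use assms in auto)

lemma anchored_in_seq_space:
  assumes "space M = D" "a \<in> seq_space D" "x \<in> space (fin_measure M d) \<union> seq_space D"
  shows "anchored d a x \<in> seq_space D"
  using assms
  by (auto simp: seq_space_def fin_measure_def space_PiM anchored_def merge_def PiE_iff extensional_def)

lemma space_seq_measure: "space (seq_measure M) = seq_space (space M)"
  by (simp add: seq_measure_def seq_space_def space_PiM)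

lemma pair_prob_space_seq_fin:
  assumes "prob_space M"
  shows "pair_prob_space (PiM {1::nat..} (\<lambda>_. M)) (PiM {1..d} (\<lambda>_. M))"
proof -
  interpret P: prob_space "PiM {1::nat..} (\<lambda>_. M)" by (rule prob_space_PiM) (rule assms)
  interpret Q: prob_space "PiM {1..d} (\<lambda>_. M)" by (rule prob_space_PiM) (rule assms)
  show ?thesis by unfold_locales
qed

lemma prob_space_seq_measure:
  assumes "prob_space M"
  shows "prob_space (seq_measure M)"
  unfolding seq_measure_def
  by (intro prob_space.prob_space_completion prob_space_PiM) (rule assms)

text \<open>The set of points sharing the tail of \<open>a\<close> may be null, so the restriction of an almost everywhere
  property to it can only be controlled for almost every \<open>a\<close>. One exceptional set of anchors
  serves all \<open>d\<close>, because there are countably many.\<close>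

lemma AE_anchored:
  assumes M: "prob_space M" and Q: "AE y in seq_measure M. Q y"
  shows "AE a in seq_measure M. \<forall>d. AE x in fin_measure M d. Q (anchored d a x)"
  unfolding AE_all_countable
proof
  fix d :: nat
  interpret pair_prob_space "PiM {1::nat..} (\<lambda>_. M)" "PiM {1..d} (\<lambda>_. M)"
    by (rule pair_prob_space_seq_fin[OF M])
  have "AE y in distr (PiM {1..} (\<lambda>_. M) \<Otimes>\<^sub>M PiM {1..d} (\<lambda>_. M)) (PiM {1..} (\<lambda>_. M))
      (\<lambda>(a, x). anchored d a x). Q y"
    using Q unfolding distr_anchored[OF M] seq_measure_def AE_completion_iff .
  from AE_pair[OF AE_distrD[OF measurable_anchored this]]
  show "AE a in seq_measure M. AE x in fin_measure M d. Q (anchored d a x)"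
    unfolding seq_measure_def fin_measure_def AE_completion_iff by (simp del: One_nat_def)
qed

lemma Fubini_anchored:
  fixes h :: "(nat \<Rightarrow> real) \<Rightarrow> real"
  assumes M: "prob_space M" and h: "integrable (seq_measure M) h"
  shows "AE a in seq_measure M. integrable (fin_measure M d) (\<lambda>x. h (anchored d a x))"
    and "(\<integral>a. (\<integral>x. h (anchored d a x) \<partial>fin_measure M d) \<partial>seq_measure M) = integral\<^sup>L (seq_measure M) h"
proof -
  let ?P = "PiM {1::nat..} (\<lambda>_. M)" and ?Q = "PiM {1..d} (\<lambda>_. M)"
  interpret pair_prob_space ?P ?Q by (rule pair_prob_space_seq_fin[OF M])
  obtain h' where h': "integrable ?P h'" and eq: "AE x in ?P. h x = h' x"
    and int_h: "integral\<^sup>L (seq_measure M) h = integral\<^sup>L ?P h'"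
    unfolding seq_measure_def by (rule integrable_completion_obtain_AE[OF h[unfolded seq_measure_def]])
  have "integrable (?P \<Otimes>\<^sub>M ?Q) (\<lambda>p. h' (case p of (a, x) \<Rightarrow> anchored d a x))"
    using h' by (intro integrable_distr[OF measurable_anchored]) (simp only: distr_anchored[OF M])
  then have prod: "integrable (?P \<Otimes>\<^sub>M ?Q) (\<lambda>(a, x). h' (anchored d a x))"
    unfolding case_prod_unfold .
  have "integral\<^sup>L (distr (?P \<Otimes>\<^sub>M ?Q) ?P (\<lambda>(a, x). anchored d a x)) h'
      = (\<integral>p. h' (case p of (a, x) \<Rightarrow> anchored d a x) \<partial>(?P \<Otimes>\<^sub>M ?Q))"
    using h' by (intro integral_distr[OF measurable_anchored]) simp
  then have int_prod: "integral\<^sup>L ?P h' = (\<integral>a. (\<integral>x. h' (anchored d a x) \<partial>?Q) \<partial>?P)"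
    unfolding distr_anchored[OF M] integral_fst[OF prod] unfolding case_prod_unfold .
  \<comment> \<open>For almost every anchor the section of \<open>h\<close> is an almost everywhere modification of the
    section of \<open>h'\<close>, and hence measurable for the completed measure.\<close>
  have sections: "AE a in ?P. integrable (fin_measure M d) (\<lambda>x. h (anchored d a x)) \<and>
      (\<integral>x. h (anchored d a x) \<partial>fin_measure M d) = (\<integral>x. h' (anchored d a x) \<partial>?Q)"
  proof -
    have "AE a in seq_measure M. \<forall>d. AE x in fin_measure M d. h (anchored d a x) = h' (anchored d a x)"
      by (rule AE_anchored[OF M]) (unfold seq_measure_def AE_completion_iff, rule eq)
    then have "AE a in ?P. AE x in ?Q. h (anchored d a x) = h' (anchored d a x)"
      unfolding seq_measure_def fin_measure_def AE_completion_iff by eventually_elim simp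
    then show ?thesis
      using AE_integrable_fst[OF prod] unfolding fin_measure_def
      by eventually_elim (blast intro: integrable_completion_AE)
  qed
  show "AE a in seq_measure M. integrable (fin_measure M d) (\<lambda>x. h (anchored d a x))"
    using sections unfolding seq_measure_def AE_completion_iff by eventually_elim simp
  have "(\<integral>a. (\<integral>x. h (anchored d a x) \<partial>fin_measure M d) \<partial>completion ?P)
      = (\<integral>a. (\<integral>x. h' (anchored d a x) \<partial>?Q) \<partial>?P)"
    by (rule integrable_completion_AE(2)[OF integrable_fst[OF prod]])
       (use sections in \<open>eventually_elim, simp\<close>)
  then show "(\<integral>a. (\<integral>x. h (anchored d a x) \<partial>fin_measure M d) \<partial>seq_measure M)
      = integral\<^sup>L (seq_measure M) h"
    unfolding int_h int_prod by (simp add: seq_measure_def)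
qed

text \<open>If \<open>h\<close> sees only the first \<open>d\<close> variables, its section does not depend on the anchor. So what
  Fubini's theorem says about almost every anchor holds for each of them, and averaging over the
  anchors has no effect. Even the measurability of the section for the completed finite product
  comes from this argument.\<close>

lemma integral_anchored_depends_on_first:
  assumes M: "prob_space M" and D: "space M = D" and dep: "depends_on_first D d h"
    and h: "integrable (seq_measure M) h" and a: "a \<in> seq_space D"
  shows "integrable (fin_measure M d) (\<lambda>x. h (anchored d a x))"
    and "(\<integral>x. h (anchored d a x) \<partial>fin_measure M d) = integral\<^sup>L (seq_measure M) h"
proof -
  interpret P: prob_space "seq_measure M" by (rule prob_space_seq_measure[OF M])
  have indep: "h (anchored d b x) = h (anchored d a x)"
    if "b \<in> space (seq_measure M)" "x \<in> space (fin_measure M d)" for b x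
  proof -
    have "anchored d b x \<in> seq_space D" "anchored d a x \<in> seq_space D"
      using that a anchored_in_seq_space[OF D] by (auto simp: space_seq_measure D)
    moreover have "\<forall>i\<in>{1..d}. anchored d b x i = anchored d a x i"
      by (simp add: anchored_def)
    ultimately show ?thesis using dep unfolding depends_on_first_def by blast
  qed
  have "AE b in seq_measure M. integrable (fin_measure M d) (\<lambda>x. h (anchored d a x))"
    using Fubini_anchored(1)[OF M h, of d] AE_space
    by eventually_elim
       (erule Bochner_Integration.integrable_cong[OF refl, THEN iffD1, rotated], rule indep)
  then show "integrable (fin_measure M d) (\<lambda>x. h (anchored d a x))" by simp
  have "(\<integral>b. (\<integral>x. h (anchored d b x) \<partial>fin_measure M d) \<partial>seq_measure M)
      = (\<integral>b. (\<integral>x. h (anchored d a x) \<partial>fin_measure M d) \<partial>seq_measure M)"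
    by (intro Bochner_Integration.integral_cong refl) (rule indep)
  then show "(\<integral>x. h (anchored d a x) \<partial>fin_measure M d) = integral\<^sup>L (seq_measure M) h"
    unfolding Fubini_anchored(2)[OF M h] by (simp add: P.prob_space)
qed

section \<open>Convergence of the anchored integrals\<close>

text \<open>This is the convergence argument proper, for a single fixed anchor: both \<open>F\<^sub>d\<close> and the bound \<open>g\<close> keep their
  integrals when anchored, so the error of the anchored integral of \<open>f\<close> is at most \<open>\<integral> g < e\<close>.\<close>

lemma anchored_integrals_converge_if_approximable:
  assumes M: "prob_space M" and D: "space M = D"
    and F: "converges_dominantly (seq_measure M) F f"
    and dep: "\<And>d. depends_on_first D d (F d)"
    and a: "a \<in> seq_space D"
    and int: "\<And>d. integrable (fin_measure M d) (\<lambda>x. f (anchored d a x))"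
    and approx: "\<And>e. e > 0 \<Longrightarrow> \<forall>\<^sub>F d in sequentially. \<exists>g.
      depends_on_first D d g \<and> integrable (seq_measure M) g \<and> integral\<^sup>L (seq_measure M) g < e \<and>
      (AE x in fin_measure M d. \<bar>F d (anchored d a x) - f (anchored d a x)\<bar> \<le> g (anchored d a x))"
  shows "anchored_integrals_converge M f a"
proof -
  let ?I = "\<lambda>d. \<integral>x. f (anchored d a x) \<partial>fin_measure M d"
  let ?J = "\<lambda>d. integral\<^sup>L (seq_measure M) (F d)"
  have F_int: "integrable (seq_measure M) (F d)" for d
    using F by (simp add: converges_dominantly_def)
  have lim: "integrable (seq_measure M) f" "?J \<longlonglongrightarrow> integral\<^sup>L (seq_measure M) f"
    using integral_converges_dominantly F unfolding seq_measure_def by blast+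
  have "(\<lambda>d. ?J d - ?I d) \<longlonglongrightarrow> 0"
  proof (rule tendstoI)
    fix e :: real assume "e > 0"
    from approx[OF this] show "\<forall>\<^sub>F d in sequentially. dist (?J d - ?I d) 0 < e"
    proof eventually_elim
      case (elim d)
      then obtain g where g: "depends_on_first D d g" "integrable (seq_measure M) g"
        "integral\<^sup>L (seq_measure M) g < e"
        and le: "AE x in fin_measure M d. \<bar>F d (anchored d a x) - f (anchored d a x)\<bar> \<le> g (anchored d a x)"
        by blast
      note F_anch = integral_anchored_depends_on_first[OF M D dep F_int a]
      note g_anch = integral_anchored_depends_on_first[OF M D g(1,2) a]
      have diff: "integrable (fin_measure M d) (\<lambda>x. F d (anchored d a x) - f (anchored d a x))"
        by (intro Bochner_Integration.integrable_diff F_anch int)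
      have "\<bar>?J d - ?I d\<bar> = \<bar>\<integral>x. F d (anchored d a x) - f (anchored d a x) \<partial>fin_measure M d\<bar>"
        using F_anch int by simp
      also have "\<dots> \<le> (\<integral>x. \<bar>F d (anchored d a x) - f (anchored d a x)\<bar> \<partial>fin_measure M d)"
        by (rule integral_abs_bound)
      also have "\<dots> \<le> (\<integral>x. g (anchored d a x) \<partial>fin_measure M d)"
        by (intro integral_mono_AE integrable_abs diff g_anch le)
      also have "\<dots> = integral\<^sup>L (seq_measure M) g" by (rule g_anch)
      finally show ?case using g(3) by simp
    qed
  qed
  from tendsto_diff[OF lim(2) this] have "?I \<longlonglongrightarrow> integral\<^sup>L (seq_measure M) f" by simp
  with lim(1) int show ?thesis unfolding anchored_integrals_converge_def by blast
qed

lemma dominant_null_sequence_integral_small: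
  assumes "dominant_null_sequence D M g" and "e > 0"
  shows "\<forall>\<^sub>F d in sequentially. depends_on_first D d (g d) \<and> integrable (seq_measure M) (g d) \<and>
    integral\<^sup>L (seq_measure M) (g d) < e"
proof -
  have "(\<lambda>d. integral\<^sup>L (seq_measure M) (g d)) \<longlonglongrightarrow> 0"
    using integral_converges_dominantly(2)[of _ g "\<lambda>_. 0"] assms(1)
    by (simp add: dominant_null_sequence_def seq_measure_def)
  from order_tendstoD(2)[OF this \<open>e > 0\<close>] show ?thesis
    by eventually_elim (use assms(1) in \<open>auto simp: dominant_null_sequence_def converges_dominantly_def\<close>)
qed

text \<open>The property \<open>Q\<close> describes the points at which the error bounds hold: the complement of an
  exceptional null set for uniform convergence, the pointwise bound itself for a dominating
  sequence. It is the same for all \<open>e\<close>, so that a single null set of anchors is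
  excluded.\<close>

lemma AE_anchored_integrals_converge:
  assumes M: "prob_space M" and D: "space M = D"
    and F: "converges_dominantly (seq_measure M) F f"
    and dep: "\<And>d. depends_on_first D d (F d)"
    and Q: "AE y in seq_measure M. Q y"
    and approx: "\<And>e. e > 0 \<Longrightarrow> \<forall>\<^sub>F d in sequentially. \<exists>g.
      depends_on_first D d g \<and> integrable (seq_measure M) g \<and> integral\<^sup>L (seq_measure M) g < e \<and>
      (\<forall>y\<in>seq_space D. Q y \<longrightarrow> \<bar>F d y - f y\<bar> \<le> g y)"
  shows "AE a in seq_measure M. anchored_integrals_converge M f a"
proof -
  have "integrable (seq_measure M) f"
    using integral_converges_dominantly(1) F unfolding seq_measure_def by blast
  from Fubini_anchored(1)[OF M this]
  have "AE a in seq_measure M. \<forall>d. integrable (fin_measure M d) (\<lambda>x. f (anchored d a x))"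
    unfolding AE_all_countable by blast
  then show ?thesis
    using AE_anchored[OF M Q] AE_space
  proof eventually_elim
    case (elim a)
    have a: "a \<in> seq_space D" using elim(3) by (simp add: space_seq_measure D)
    show ?case
    proof (rule anchored_integrals_converge_if_approximable[OF M D F dep a])
      show "integrable (fin_measure M d) (\<lambda>x. f (anchored d a x))" for d
        using elim(1) by blast
      fix e :: real assume "e > 0"
      from approx[OF this]
      show "\<forall>\<^sub>F d in sequentially. \<exists>g. depends_on_first D d g \<and> integrable (seq_measure M) g \<and>
          integral\<^sup>L (seq_measure M) g < e \<and>
          (AE x in fin_measure M d. \<bar>F d (anchored d a x) - f (anchored d a x)\<bar> \<le> g (anchored d a x))"
      proof (rule eventually_mono, elim exE conjE, intro exI conjI)
        fix d g assume g: "\<forall>y\<in>seq_space D. Q y \<longrightarrow> \<bar>F d y - f y\<bar> \<le> g y"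
        have "AE x in fin_measure M d. Q (anchored d a x)" using elim(2) by blast
        then show "AE x in fin_measure M d. \<bar>F d (anchored d a x) - f (anchored d a x)\<bar> \<le> g (anchored d a x)"
          using AE_space by eventually_elim (use g anchored_in_seq_space[OF D a] in blast)
      qed
    qed
  qed
qed

text \<open>With the bound valid at every point, \<open>\<bar>f\<bar> \<le> \<bar>F\<^sub>d\<bar> + g\<^sub>d\<close> can be evaluated at
  anchored points, where the right-hand side sees the first \<open>d\<close> variables only. Thus the section of
  \<open>f\<close> is dominated by an integrable function of these variables, for each \<open>d\<close> and each
  anchor for which it is measurable.\<close>

lemma anchored_integrals_converge_pointwise:
  assumes M: "prob_space M" and D: "space M = D"
    and F: "converges_dominantly (seq_measure M) F f"
    and dep: "\<And>d. depends_on_first D d (F d)"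
    and g: "dominant_null_sequence D M g"
    and le: "\<And>y d. y \<in> seq_space D \<Longrightarrow> \<bar>F d y - f y\<bar> \<le> g d y"
    and a: "a \<in> seq_space D"
    and meas: "\<And>d. (\<lambda>x. f (anchored d a x)) \<in> borel_measurable (seq_measure M)"
  shows "anchored_integrals_converge M f a"
proof (rule anchored_integrals_converge_if_approximable[OF M D F dep a])
  fix d
  let ?k = "\<lambda>x. f (anchored d a x)"
  have F_int: "integrable (seq_measure M) (F d)" and g_int: "integrable (seq_measure M) (g d)"
    and g_dep: "depends_on_first D d (g d)"
    using F g by (auto simp: converges_dominantly_def dominant_null_sequence_def)
  have bound: "\<bar>?k x\<bar> \<le> \<bar>F d x\<bar> + g d x" if x: "x \<in> seq_space D" for x
  proof -
    have y: "anchored d a x \<in> seq_space D" using anchored_in_seq_space[OF D a] x by blast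
    have "\<forall>i\<in>{1..d}. anchored d a x i = x i" by (simp add: anchored_def)
    then have "F d (anchored d a x) = F d x" "g d (anchored d a x) = g d x"
      using dep[of d] g_dep x y unfolding depends_on_first_def by blast+
    then show ?thesis using le[OF y, of d] by linarith
  qed
  have "integrable (seq_measure M) (\<lambda>x. \<bar>F d x\<bar> + g d x)"
    using F_int g_int by simp
  then have k_int: "integrable (seq_measure M) ?k"
  proof (rule Bochner_Integration.integrable_bound[OF _ meas])
    show "AE x in seq_measure M. norm (?k x) \<le> norm (\<bar>F d x\<bar> + g d x)"
      using AE_space by eventually_elim (use bound in \<open>force simp: space_seq_measure D\<close>)
  qed
  have "?k x = ?k y" if "\<forall>i\<in>{1..d}. x i = y i" for x y
    using that by (intro arg_cong[of _ _ f]) (auto simp: anchored_def merge_def)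
  then have k_dep: "depends_on_first D d ?k"
    unfolding depends_on_first_def by blast
  \<comment> \<open>Anchoring is idempotent, so anchoring \<open>?k\<close>, a function of the first \<open>d\<close> variables, gives
    back \<open>?k\<close>; this carries its integrability from the infinite to the finite product.\<close>
  have "anchored d a (anchored d a x) = anchored d a x" for x
    by (auto simp: anchored_def merge_def)
  then show "integrable (fin_measure M d) ?k"
    using integral_anchored_depends_on_first(1)[OF M D k_dep k_int a] by simp
next
  fix e :: real assume "e > 0"
  from dominant_null_sequence_integral_small[OF g this]
  show "\<forall>\<^sub>F d in sequentially. \<exists>g. depends_on_first D d g \<and> integrable (seq_measure M) g \<and>
      integral\<^sup>L (seq_measure M) g < e \<and>
      (AE x in fin_measure M d. \<bar>F d (anchored d a x) - f (anchored d a x)\<bar> \<le> g (anchored d a x))"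
  proof eventually_elim
    case (elim d)
    have "AE x in fin_measure M d. \<bar>F d (anchored d a x) - f (anchored d a x)\<bar> \<le> g d (anchored d a x)"
      using AE_space by eventually_elim (use le anchored_in_seq_space[OF D a] in blast)
    with elim show ?case by (intro exI[of _ "g d"]) simp
  qed
qed

theorem theorem2:
  fixes D :: "real set" and M :: "real measure"
    and F :: "nat \<Rightarrow> (nat \<Rightarrow> real) \<Rightarrow> real" and f :: "(nat \<Rightarrow> real) \<Rightarrow> real"
  assumes "D \<in> sets borel"
    and "prob_space M" and "sets M = sets (restrict_space borel D)"
    and "converges_dominantly (seq_measure M) F f"
    and "\<And>d. depends_on_first D d (F d)"
    and "converges_uniformly_ae (seq_measure M) F f \<or>
         (\<exists>g. dominant_null_sequence D M g \<and>
              (AE x in seq_measure M. \<forall>d. \<bar>F d x - f x\<bar> \<le> g d x))"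
  shows "(AE a in seq_measure M. anchored_integrals_converge M f a) \<and>
         ((\<exists>g. dominant_null_sequence D M g \<and>
               (\<forall>x\<in>seq_space D. \<forall>d. \<bar>F d x - f x\<bar> \<le> g d x)) \<longrightarrow>
          (\<forall>a\<in>seq_space D.
             (\<forall>d. (\<lambda>x. f (anchored d a x)) \<in> borel_measurable (seq_measure M)) \<longrightarrow>
             anchored_integrals_converge M f a))"
proof -
  have D: "space M = D"
    using sets_eq_imp_space_eq[OF assms(3)] by (simp add: space_restrict_space)
  interpret P: prob_space "seq_measure M" by (rule prob_space_seq_measure[OF assms(2)])
  have ae: "AE a in seq_measure M. anchored_integrals_converge M f a"
    using assms(6)
  proof (elim disjE exE conjE)
    assume "converges_uniformly_ae (seq_measure M) F f"
    then obtain Z where Z: "Z \<in> null_sets (seq_measure M)"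
      and unif: "uniform_limit (space (seq_measure M) - Z) F f sequentially"
      unfolding converges_uniformly_ae_def by blast
    show ?thesis
    proof (rule AE_anchored_integrals_converge[OF assms(2) D assms(4,5) AE_not_in[OF Z]])
      fix e :: real assume "e > 0"
      \<comment> \<open>The constant \<open>e / 2\<close> serves as the bound; its integral has to be strictly below \<open>e\<close>.\<close>
      then have "e / 2 > 0" by simp
      from uniform_limitD[OF unif this]
      show "\<forall>\<^sub>F d in sequentially. \<exists>g. depends_on_first D d g \<and> integrable (seq_measure M) g \<and>
          integral\<^sup>L (seq_measure M) g < e \<and> (\<forall>y\<in>seq_space D. y \<notin> Z \<longrightarrow> \<bar>F d y - f y\<bar> \<le> g y)"
      proof eventually_elim
        case (elim d)
        then have "\<forall>y\<in>seq_space D. y \<notin> Z \<longrightarrow> \<bar>F d y - f y\<bar> \<le> e / 2"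
          by (auto simp: space_seq_measure D dist_real_def intro: less_imp_le)
        moreover have "integral\<^sup>L (seq_measure M) (\<lambda>_. e / 2) < e"
          using \<open>e > 0\<close> by (simp add: P.prob_space)
        ultimately show ?case
          by (intro exI[of _ "\<lambda>_. e / 2"]) (auto simp: depends_on_first_def)
      qed
    qed
  next
    fix g assume g: "dominant_null_sequence D M g"
      and le: "AE x in seq_measure M. \<forall>d. \<bar>F d x - f x\<bar> \<le> g d x"
    show ?thesis
    proof (rule AE_anchored_integrals_converge[OF assms(2) D assms(4,5) le])
      fix e :: real assume "e > 0"
      from dominant_null_sequence_integral_small[OF g this]
      show "\<forall>\<^sub>F d in sequentially. \<exists>h. depends_on_first D d h \<and> integrable (seq_measure M) h \<and>
          integral\<^sup>L (seq_measure M) h < e \<and>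
          (\<forall>y\<in>seq_space D. (\<forall>d. \<bar>F d y - f y\<bar> \<le> g d y) \<longrightarrow> \<bar>F d y - f y\<bar> \<le> h y)"
        by eventually_elim (rule exI[of _ "g _"], auto)
    qed
  qed
  show ?thesis
  proof (intro conjI ae impI ballI, elim exE conjE)
    fix a g assume a: "a \<in> seq_space D" and g: "dominant_null_sequence D M g"
      and meas: "\<forall>d. (\<lambda>x. f (anchored d a x)) \<in> borel_measurable (seq_measure M)"
      and le: "\<forall>x\<in>seq_space D. \<forall>d. \<bar>F d x - f x\<bar> \<le> g d x"
    show "anchored_integrals_converge M f a"
      by (rule anchored_integrals_converge_pointwise[OF assms(2) D assms(4,5) g _ a])
         (use le meas in auto)
  qed
qed

end
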